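(* Let $(\mathcal{R},\partial,\int)$ be a commutative integro-differential ring with constants $\mathcal{C}$ and induced evaluation $\mathrm{E}$. Let $f,g\in\mathcal{C}\langle\mathcal{R}\rangle$ be pure tensors of length $m$ and $n$, respectively. Then the product of the nested integrals $\varphi(f)=\int f_1\int f_2\cdots\int f_m$ and $\varphi(g)=\int g_1\int g_2\cdots\int g_n$ is given by $$\varphi(f)\varphi(g)=\varphi(f\mathbin{\sqcup\!\sqcup}g)+\sum_{i=0}^{m-1}\sum_{j=0}^{n-1}e(f_{i+1}^m,g_{j+1}^n)\,\varphi\bigl(f_1^i\mathbin{\sqcup\!\sqcup}g_1^j\bigr)\in\mathcal{R}$$ with constants $e(f_{i+1}^m,g_{j+1}^n):=\mathrm{E}\bigl(\varphi(f_{i+1}^m)\varphi(g_{j+1}^n)\bigr)\in\mathcal{C}$.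
   Context: Rings are unital and nonzero. A derivation on a ring $\mathcal{R}$ is an additive map $\partial$ with $\partial(fg)=(\partial f)g+f\,\partial g$; $\mathcal{C}=\{f\in\mathcal{R}:\partial f=0\}$ is the ring of constants. An integro-differential ring $(\mathcal{R},\partial,\int)$ is a differential ring together with a $\mathcal{C}$-linear map $\int\colon\mathcal{R}\to\mathcal{R}$ satisfying $\partial\int f=f$ for all $f$. Its induced evaluation is $\mathrm{E}f:=f-\int\partial f$ (with values in $\mathcal{C}$). Let $\mathcal{C}\langle\mathcal{R}\rangle:=\bigoplus_{n\ge0}\mathcal{R}^{\otimes n}$ with tensor products over $\mathcal{C}$ and $\mathcal{R}^{\otimes0}=\mathcal{C}\varepsilon$, where $\varepsilon$ is the empty tensor. Pure tensors of length $n\geq 1$ are $a=a_1\otimes\dots\otimes a_n$ with $a_i\in\mathcal{R}$; pure tensors of length $0$ are $c\varepsilon$, $c\in\mathcal{C}$. The $\mathcal{C}$-module homomorphism $\varphi\colon\mathcal{C}\langle\mathcal{R}\rangle\to\mathcal{R}$ is determined by $\varphi(\varepsilon)=1$ and $\varphi(a_1\otimes\dots\otimes a_n)=\int a_1\int a_2\cdots\int a_n$, meaning $\int(a_1\int(a_2\cdots\int(a_n)))$. For a pure tensor $a=a_1\otimes\dots\otimes a_n$ one writes $a_i^j:=a_i\otimes a_{i+1}\otimes\dots\otimes a_j$, with $a_i^j:=\varepsilon$ if $i=j+1$. The shuffle product $\sqcup\!\sqcup$ on $\mathcal{C}\langle\mathcal{R}\rangle$ is the $\mathcal{C}$-bilinear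 product given on pure tensors $a,b$ of lengths $m,n$ by $a\mathbin{\sqcup\!\sqcup}b:=a\otimes b$ (concatenation) if $m=0$ or $n=0$, and otherwise recursively by $a\mathbin{\sqcup\!\sqcup}b:=a_1\otimes(a_2^m\mathbin{\sqcup\!\sqcup}b)+b_1\otimes(a\mathbin{\sqcup\!\sqcup}b_2^n)$. *)

theory Defs
  imports Main HOL.Modules "HOL-Library.Poly_Mapping"
begin

section \<open>Commutative integro-differential rings\<close>

class comm_integro_differential_ring = comm_ring_1 +
  fixes derivation :: "'a \<Rightarrow> 'a" ("\<partial>")
    and integral :: "'a \<Rightarrow> 'a" ("\<integral>")
  assumes derivation_add: "\<partial> (f + g) = \<partial> f + \<partial> g"
    and derivation_mult: "\<partial> (f * g) = \<partial> f * g + f * \<partial> g"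
    and integral_add: "\<integral> (f + g) = \<integral> f + \<integral> g"
    and integral_const_mult: "\<partial> c = 0 \<Longrightarrow> \<integral> (c * f) = c * \<integral> f"
    and derivation_integral: "\<partial> (\<integral> f) = f"

definition constants :: "'a::comm_integro_differential_ring set"
  where "constants = {f. \<partial> f = 0}"

definition evaluation :: "'a::comm_integro_differential_ring \<Rightarrow> 'a" ("\<E>")
  where "\<E> f = f - \<integral> (\<partial> f)"

lemma derivation_0: "\<partial> 0 = (0::'a::comm_integro_differential_ring)"
  using derivation_add[of "0::'a" 0] by simp

lemma derivation_1: "\<partial> 1 = (0::'a::comm_integro_differential_ring)"
  using derivation_mult[of "1::'a" 1] by simp

lemma derivation_minus: "\<partial> (- f) = - \<partial> (f::'a::comm_integro_differential_ring)"
  using derivation_add[of f "- f"] by (simp add: derivation_0 eq_neg_iff_add_eq_0 add.commute)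

text \<open>The constants as a type of their own, so that they can act as scalars.\<close>

typedef (overloaded) 'a const = "constants :: 'a::comm_integro_differential_ring set"
  morphisms of_const Const
  by (rule exI[of _ 0]) (simp add: constants_def derivation_0)

setup_lifting type_definition_const

instantiation const :: (comm_integro_differential_ring) comm_ring_1
begin

lift_definition zero_const :: "'a const" is 0
  by (simp add: constants_def derivation_0)
lift_definition one_const :: "'a const" is 1
  by (simp add: constants_def derivation_1)
lift_definition plus_const :: "'a const \<Rightarrow> 'a const \<Rightarrow> 'a const" is "(+)"
  by (simp add: constants_def derivation_add)
lift_definition uminus_const :: "'a const \<Rightarrow> 'a const" is uminus
  by (simp add: constants_def derivation_minus)
lift_definition minus_const :: "'a const \<Rightarrow> 'a const \<Rightarrow> 'a const" is "(-)"
  by (simp add: constants_def derivation_add derivation_minus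
      flip: add_uminus_conv_diff)
lift_definition times_const :: "'a const \<Rightarrow> 'a const \<Rightarrow> 'a const" is "(*)"
  by (simp add: constants_def derivation_mult)

instance
  by standard (transfer; simp add: algebra_simps)+

end

lemma derivation_of_const: "\<partial> (of_const c) = 0"
  using of_const[of c] by (simp add: constants_def)

definition ring_scale :: "'a::comm_integro_differential_ring const \<Rightarrow> 'a \<Rightarrow> 'a"
  where "ring_scale c x = of_const c * x"

lemma module_ring_scale: "module ring_scale"
  by standard
    (simp_all add: ring_scale_def algebra_simps plus_const.rep_eq times_const.rep_eq
      one_const.rep_eq)


section \<open>The free module on words\<close>

type_synonym 'a free_words = "'a list \<Rightarrow>\<^sub>0 'a const"

definition free_scale ::
    "'a::comm_integro_differential_ring const \<Rightarrow> 'a free_words \<Rightarrow> 'a free_words"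
  where "free_scale c p = Poly_Mapping.map ((*) c) p"

lemma lookup_free_scale:
  "Poly_Mapping.lookup (free_scale c p) w = c * Poly_Mapping.lookup p w"
  unfolding free_scale_def by transfer (simp add: when_def)

global_interpretation free: module free_scale
  by standard
    (simp_all add: poly_mapping_eq_iff fun_eq_iff lookup_free_scale lookup_add algebra_simps)

definition linear_extension ::
    "('a::comm_integro_differential_ring const \<Rightarrow> 'b \<Rightarrow> 'b::ab_group_add) \<Rightarrow>
      ('a list \<Rightarrow> 'b) \<Rightarrow> 'a free_words \<Rightarrow> 'b"
  where "linear_extension scale h p =
    (\<Sum>w\<in>Poly_Mapping.keys p. scale (Poly_Mapping.lookup p w) (h w))"

lemma linear_extension_superset:
  assumes "module scale" "finite S" "Poly_Mapping.keys p \<subseteq> S"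
  shows "linear_extension scale h p = (\<Sum>w\<in>S. scale (Poly_Mapping.lookup p w) (h w))"
proof -
  interpret module scale by fact
  show ?thesis
    unfolding linear_extension_def using assms(2,3)
    by (intro sum.mono_neutral_left) (auto simp: in_keys_iff)
qed

lemma module_hom_linear_extension:
  assumes "module scale"
  shows "module_hom free_scale scale (linear_extension scale h)"
proof -
  interpret module scale by fact
  show ?thesis
  proof (rule module_hom.intro[OF free.module_axioms assms], unfold_locales)
    fix p q :: "'a free_words" and c
    let ?S = "Poly_Mapping.keys p \<union> Poly_Mapping.keys q"
    have "linear_extension scale h (p + q) =
        (\<Sum>w\<in>?S. scale (Poly_Mapping.lookup (p + q) w) (h w))"
      by (rule linear_extension_superset[OF assms]) (auto simp: keys_add)
    moreover have "linear_extension scale h p = (\<Sum>w\<in>?S. scale (Poly_Mapping.lookup p w) (h w))"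
      by (rule linear_extension_superset[OF assms]) auto
    moreover have "linear_extension scale h q = (\<Sum>w\<in>?S. scale (Poly_Mapping.lookup q w) (h w))"
      by (rule linear_extension_superset[OF assms]) auto
    ultimately show "linear_extension scale h (p + q) =
        linear_extension scale h p + linear_extension scale h q"
      by (simp add: lookup_add scale_left_distrib sum.distrib)
    have "linear_extension scale h (free_scale c p) =
        (\<Sum>w\<in>Poly_Mapping.keys p. scale (Poly_Mapping.lookup (free_scale c p) w) (h w))"
      by (rule linear_extension_superset[OF assms]) (auto simp: in_keys_iff lookup_free_scale)
    then show "linear_extension scale h (free_scale c p) = scale c (linear_extension scale h p)"
      by (simp add: linear_extension_def lookup_free_scale scale_sum_right)
  qed
qed

lemma linear_extension_single:
  assumes "module scale"
  shows "linear_extension scale h (Poly_Mapping.single w c) = scale c (h w)"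
proof -
  interpret module scale by fact
  show ?thesis
    using linear_extension_superset[OF assms, of "{w}" "Poly_Mapping.single w c" h] by simp
qed


section \<open>The module of tensors of arbitrary length\<close>

text \<open>
  The direct sum of the tensor powers of the ring over its constants is obtained from the free
  module on all words by imposing additivity and homogeneity in every letter. The relations only
  involve words of one length at a time, so the quotient is the direct sum of the quotients for
  the separate lengths; no relation involves the empty word, so that the component of length zero
  is free on the empty tensor.
\<close>

definition tensor_relations :: "'a::comm_integro_differential_ring free_words set"
  where "tensor_relations =
    {Poly_Mapping.single (u @ (x + y) # v) 1
      - (Poly_Mapping.single (u @ x # v) 1 + Poly_Mapping.single (u @ y # v) 1) | u x y v. True}
    \<union> {Poly_Mapping.single (u @ (of_const c * x) # v) 1
      - free_scale c (Poly_Mapping.single (u @ x # v) 1) | u c x v. True}"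

definition tensor_equiv ::
    "'a::comm_integro_differential_ring free_words \<Rightarrow> 'a free_words \<Rightarrow> bool"
  where "tensor_equiv p q \<longleftrightarrow> p - q \<in> free.span tensor_relations"

lemma tensor_equiv_refl: "p = q \<Longrightarrow> tensor_equiv p q"
  by (simp add: tensor_equiv_def free.span_zero)

quotient_type (overloaded) 'a tensors =
  "'a::comm_integro_differential_ring free_words" / tensor_equiv
proof (rule equivpI)
  show "reflp (tensor_equiv :: 'a free_words \<Rightarrow> _)"
    by (simp add: reflp_def tensor_equiv_def free.span_zero)
  show "symp (tensor_equiv :: 'a free_words \<Rightarrow> _)"
  proof (rule sympI)
    fix p q :: "'a free_words"
    assume "tensor_equiv p q"
    then show "tensor_equiv q p"
      using free.span_neg[of "p - q" tensor_relations] by (simp add: tensor_equiv_def)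
  qed
  show "transp (tensor_equiv :: 'a free_words \<Rightarrow> _)"
  proof (rule transpI)
    fix p q r :: "'a free_words"
    assume "tensor_equiv p q" "tensor_equiv q r"
    then show "tensor_equiv p r"
      using free.span_add[of "p - q" tensor_relations "q - r"] by (simp add: tensor_equiv_def)
  qed
qed

instantiation tensors :: (comm_integro_differential_ring) ab_group_add
begin

lift_definition zero_tensors :: "'a tensors" is 0 .
lift_definition plus_tensors :: "'a tensors \<Rightarrow> 'a tensors \<Rightarrow> 'a tensors" is "(+)"
proof -
  fix p q r s :: "'a free_words"
  assume "tensor_equiv p q" "tensor_equiv r s"
  then show "tensor_equiv (p + r) (q + s)"
    using free.span_add[of "p - q" tensor_relations "r - s"]
    by (simp add: tensor_equiv_def algebra_simps)
qed
lift_definition uminus_tensors :: "'a tensors \<Rightarrow> 'a tensors" is uminus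
proof -
  fix p q :: "'a free_words"
  assume "tensor_equiv p q"
  then show "tensor_equiv (- p) (- q)"
    using free.span_neg[of "p - q" tensor_relations] by (simp add: tensor_equiv_def algebra_simps)
qed
lift_definition minus_tensors :: "'a tensors \<Rightarrow> 'a tensors \<Rightarrow> 'a tensors" is "(-)"
proof -
  fix p q r s :: "'a free_words"
  assume "tensor_equiv p q" "tensor_equiv r s"
  then show "tensor_equiv (p - r) (q - s)"
    using free.span_diff[of "p - q" tensor_relations "r - s"]
    by (simp add: tensor_equiv_def algebra_simps)
qed

instance
  by standard (transfer; rule tensor_equiv_refl; simp add: algebra_simps)+

end

lift_definition scale_tensors ::
    "'a::comm_integro_differential_ring const \<Rightarrow> 'a tensors \<Rightarrow> 'a tensors" (infixr "\<bullet>" 80)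
  is free_scale
proof -
  fix c and p q :: "'a free_words"
  assume "tensor_equiv p q"
  then show "tensor_equiv (free_scale c p) (free_scale c q)"
    using free.span_scale[of "p - q" tensor_relations c]
    by (simp add: tensor_equiv_def free.scale_right_diff_distrib)
qed

global_interpretation tensors: module scale_tensors
  by standard
    (transfer; rule tensor_equiv_refl;
      simp add: free.scale_right_distrib free.scale_left_distrib)+

text \<open>\<open>tensor [a\<^sub>1, \<dots>, a\<^sub>n]\<close> is the tensor of \<open>a\<^sub>1, \<dots>, a\<^sub>n\<close>.\<close>

lift_definition tensor :: "'a::comm_integro_differential_ring list \<Rightarrow> 'a tensors"
  is "\<lambda>w. Poly_Mapping.single w 1" .

abbreviation empty_tensor :: "'a::comm_integro_differential_ring tensors" ("\<epsilon>")
  where "\<epsilon> \<equiv> tensor []"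

lemma tensor_add: "tensor (u @ (x + y) # v) = tensor (u @ x # v) + tensor (u @ y # v)"
  by transfer
    (unfold tensor_equiv_def tensor_relations_def, rule free.span_base, blast)

lemma tensor_scale: "tensor (u @ (of_const c * x) # v) = c \<bullet> tensor (u @ x # v)"
  by transfer
    (unfold tensor_equiv_def tensor_relations_def, rule free.span_base, blast)


subsection \<open>Linear maps out of it\<close>

definition multilinear ::
    "('a::comm_integro_differential_ring const \<Rightarrow> 'b \<Rightarrow> 'b::ab_group_add) \<Rightarrow>
      ('a list \<Rightarrow> 'b) \<Rightarrow> bool"
  where "multilinear scale h \<longleftrightarrow>
    (\<forall>u x y v. h (u @ (x + y) # v) = h (u @ x # v) + h (u @ y # v)) \<and>
    (\<forall>u c x v. h (u @ (of_const c * x) # v) = scale c (h (u @ x # v)))"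

text \<open>
  The value below does not depend on the chosen representative if \<open>h\<close> is multilinear, and it is
  then the unique linear map that agrees with \<open>h\<close> on words; see \<open>tensor_lift_tensor\<close>,
  \<open>module_hom_tensor_lift\<close> and \<open>tensors_hom_eqI\<close>. It is used only for such \<open>h\<close>.
\<close>

definition tensor_lift ::
    "('a::comm_integro_differential_ring const \<Rightarrow> 'b \<Rightarrow> 'b::ab_group_add) \<Rightarrow>
      ('a list \<Rightarrow> 'b) \<Rightarrow> 'a tensors \<Rightarrow> 'b"
  where "tensor_lift scale h t = linear_extension scale h (rep_tensors t)"

lemma tensor_lift_abs:
  assumes "module scale" "multilinear scale h"
  shows "tensor_lift scale h (abs_tensors p) = linear_extension scale h p"
proof -
  interpret L: module_hom free_scale scale "linear_extension scale h"
    by (rule module_hom_linear_extension[OF assms(1)])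
  have S: "linear_extension scale h (Poly_Mapping.single w 1) = h w" for w
    by (simp add: linear_extension_single[OF assms(1)])
  have "linear_extension scale h r = 0" if "r \<in> tensor_relations" for r
    using that assms(2)
    by (auto simp: tensor_relations_def multilinear_def L.diff L.add L.scale S)
  then have Z: "linear_extension scale h r = 0" if "r \<in> free.span tensor_relations" for r
    using L.eq_0_on_span that by blast
  have "tensor_equiv (rep_tensors (abs_tensors p)) p"
    by (rule Quotient_rep_abs[OF Quotient_tensors]) (simp add: tensor_equiv_def free.span_zero)
  then show ?thesis
    using Z by (fastforce simp: tensor_lift_def tensor_equiv_def L.diff)
qed

lemma tensor_lift_tensor:
  assumes "module scale" "multilinear scale h"
  shows "tensor_lift scale h (tensor w) = h w"
proof -
  interpret module scale by fact
  show ?thesis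
    by (simp add: tensor.abs_eq tensor_lift_abs[OF assms] linear_extension_single[OF assms(1)])
qed

lemma module_hom_tensor_lift:
  assumes "module scale" "multilinear scale h"
  shows "module_hom scale_tensors scale (tensor_lift scale h)"
proof -
  interpret L: module_hom free_scale scale "linear_extension scale h"
    by (rule module_hom_linear_extension[OF assms(1)])
  show ?thesis
  proof (rule module_hom.intro[OF tensors.module_axioms assms(1)], unfold_locales)
    fix s t :: "'a tensors" and c
    show "tensor_lift scale h (s + t) = tensor_lift scale h s + tensor_lift scale h t"
      by (induct s, induct t)
        (simp add: plus_tensors.abs_eq tensor_lift_abs[OF assms] L.add)
    show "tensor_lift scale h (c \<bullet> s) = scale c (tensor_lift scale h s)"
      by (induct s) (simp add: scale_tensors.abs_eq tensor_lift_abs[OF assms] L.scale)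
  qed
qed

lemma abs_tensors_eq: "abs_tensors p = linear_extension (\<bullet>) tensor p"
proof (induct p rule: Poly_Mapping.update_induct)
  interpret L: module_hom free_scale scale_tensors
    "linear_extension scale_tensors (tensor :: 'a list \<Rightarrow> _)"
    by (rule module_hom_linear_extension[OF tensors.module_axioms])
  {
    case const
    show ?case by (simp add: L.zero zero_tensors.abs_eq)
  next
    case (update p w c)
    have *: "Poly_Mapping.update w c p = p + free_scale c (Poly_Mapping.single w 1)"
      using update(1)
      by (auto simp: poly_mapping_eq_iff fun_eq_iff lookup_update lookup_add lookup_free_scale
          lookup_single in_keys_iff when_def)
    have "abs_tensors (p + free_scale c (Poly_Mapping.single w 1)) =
        abs_tensors p + c \<bullet> tensor w"
      by (simp add: plus_tensors.abs_eq scale_tensors.abs_eq tensor.abs_eq)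
    then show ?case
      unfolding * by (simp add: L.add L.scale linear_extension_single[OF tensors.module_axioms]
          update(3)[symmetric])
  }
qed

lemma tensors_hom_eqI:
  assumes "module_hom scale_tensors scale F" "module_hom scale_tensors scale G"
    and "\<And>w. F (tensor w) = G (tensor w)"
  shows "F = G"
proof
  fix t
  interpret F: module_hom scale_tensors scale F by fact
  interpret G: module_hom scale_tensors scale G by fact
  show "F t = G t"
    by (induct t)
      (simp add: abs_tensors_eq linear_extension_def F.sum G.sum F.scale G.scale assms(3))
qed


section \<open>Nested integrals\<close>

fun nested_integral :: "'a::comm_integro_differential_ring list \<Rightarrow> 'a"
  where "nested_integral [] = 1"
  | "nested_integral (a # w) = \<integral> (a * nested_integral w)"

lemma multilinear_nested_integral: "multilinear ring_scale nested_integral"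
proof -
  have "nested_integral (u @ (x + y) # v) = nested_integral (u @ x # v) + nested_integral (u @ y # v)"
    for u v and x y :: 'a
    by (induct u) (simp_all add: distrib_left distrib_right integral_add)
  moreover have "nested_integral (u @ (of_const c * x) # v) = of_const c * nested_integral (u @ x # v)"
    for u v and x :: 'a and c
    by (induct u)
      (simp_all add: mult.assoc mult.left_commute[of _ "of_const c"]
        integral_const_mult[OF derivation_of_const])
  ultimately show ?thesis
    by (simp add: multilinear_def ring_scale_def)
qed

definition nested_integrals :: "'a::comm_integro_differential_ring tensors \<Rightarrow> 'a" ("\<phi>")
  where "\<phi> = tensor_lift ring_scale nested_integral"

lemma phi_tensor: "\<phi> (tensor w) = nested_integral w"
  unfolding nested_integrals_def
  by (rule tensor_lift_tensor[OF module_ring_scale multilinear_nested_integral])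

lemma module_hom_phi: "module_hom scale_tensors ring_scale \<phi>"
  unfolding nested_integrals_def
  by (rule module_hom_tensor_lift[OF module_ring_scale multilinear_nested_integral])


section \<open>The shuffle product\<close>

text \<open>\<open>cons_tensor a t\<close> is the concatenation of the one-letter tensor \<open>a\<close> with \<open>t\<close>.\<close>

definition cons_tensor ::
    "'a::comm_integro_differential_ring \<Rightarrow> 'a tensors \<Rightarrow> 'a tensors"
  where "cons_tensor a = tensor_lift (\<bullet>) (\<lambda>w. tensor (a # w))"

lemma multilinear_cons: "multilinear (\<bullet>) (\<lambda>w. tensor (a # w))"
  unfolding multilinear_def by (metis append_Cons tensor_add tensor_scale)

lemma cons_tensor_tensor: "cons_tensor a (tensor w) = tensor (a # w)"
  unfolding cons_tensor_def
  by (rule tensor_lift_tensor[OF tensors.module_axioms multilinear_cons])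

lemma module_hom_cons_tensor: "module_hom (\<bullet>) (\<bullet>) (cons_tensor a)"
  unfolding cons_tensor_def
  by (rule module_hom_tensor_lift[OF tensors.module_axioms multilinear_cons])

lemma cons_tensor_add_left: "cons_tensor (x + y) t = cons_tensor x t + cons_tensor y t"
proof -
  interpret X: module_hom scale_tensors scale_tensors "cons_tensor x"
    by (rule module_hom_cons_tensor)
  interpret Y: module_hom scale_tensors scale_tensors "cons_tensor y"
    by (rule module_hom_cons_tensor)
  have "module_hom scale_tensors scale_tensors (\<lambda>t. cons_tensor x t + cons_tensor y t)"
    by unfold_locales
      (simp_all add: X.add Y.add X.scale Y.scale tensors.scale_right_distrib algebra_simps)
  from tensors_hom_eqI[OF module_hom_cons_tensor this, of "x + y"]
  show ?thesis
    using tensor_add[of "[]" x y] by (simp add: cons_tensor_tensor fun_eq_iff)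
qed

lemma cons_tensor_scale_left: "cons_tensor (of_const c * x) t = c \<bullet> cons_tensor x t"
proof -
  interpret X: module_hom scale_tensors scale_tensors "cons_tensor x"
    by (rule module_hom_cons_tensor)
  have "module_hom scale_tensors scale_tensors (\<lambda>t. c \<bullet> cons_tensor x t)"
    by unfold_locales
      (simp_all add: X.add X.scale tensors.scale_right_distrib mult.commute)
  from tensors_hom_eqI[OF module_hom_cons_tensor this, of "of_const c * x"]
  show ?thesis
    using tensor_scale[of "[]" c x] by (simp add: cons_tensor_tensor fun_eq_iff)
qed

fun shuffle_words ::
    "'a::comm_integro_differential_ring list \<Rightarrow> 'a list \<Rightarrow> 'a tensors"
  where "shuffle_words [] w = tensor w"
  | "shuffle_words (a # v) [] = tensor (a # v)"
  | "shuffle_words (a # v) (b # w) =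
      cons_tensor a (shuffle_words v (b # w)) + cons_tensor b (shuffle_words (a # v) w)"

lemma shuffle_words_Nil_right [simp]: "shuffle_words w [] = tensor w"
  by (cases w) simp_all

lemma shuffle_words_commute: "shuffle_words v w = shuffle_words w v"
  by (induct v w rule: shuffle_words.induct) (simp_all add: add.commute)

lemma multilinear_shuffle_words: "multilinear (\<bullet>) (\<lambda>v. shuffle_words v w)"
proof -
  interpret C: module_hom scale_tensors scale_tensors "cons_tensor a" for a :: 'a
    by (rule module_hom_cons_tensor)
  have "shuffle_words (u @ (x + y) # v) w = shuffle_words (u @ x # v) w + shuffle_words (u @ y # v) w"
    for u v w and x y :: 'a
  proof (induct "length u + length w" arbitrary: u w rule: less_induct)
    case less
    show ?case
    proof (cases w)
      case Nil
      then show ?thesis by (simp add: tensor_add)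
    next
      case (Cons b w')
      then show ?thesis
        using less[of u w'] less[of "tl u" w]
        by (cases u) (simp_all add: C.add cons_tensor_add_left algebra_simps)
    qed
  qed
  moreover have "shuffle_words (u @ (of_const c * x) # v) w = c \<bullet> shuffle_words (u @ x # v) w"
    for u v w c and x :: 'a
  proof (induct "length u + length w" arbitrary: u w rule: less_induct)
    case less
    show ?case
    proof (cases w)
      case Nil
      then show ?thesis by (simp add: tensor_scale)
    next
      case (Cons b w')
      then show ?thesis
        using less[of u w'] less[of "tl u" w]
        by (cases u)
          (simp_all add: C.scale cons_tensor_scale_left tensors.scale_right_distrib)
    qed
  qed
  ultimately show ?thesis
    unfolding multilinear_def by blast
qed

definition shuffle ::
    "'a::comm_integro_differential_ring tensors \<Rightarrow> 'a tensors \<Rightarrow> 'a tensors" (infixl "\<squnion>\<squnion>" 75)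
  where "s \<squnion>\<squnion> t =
    tensor_lift (\<bullet>) (\<lambda>v. tensor_lift (\<bullet>) (shuffle_words v) t) s"

lemma multilinear_shuffle_words_right: "multilinear (\<bullet>) (shuffle_words v)"
proof -
  have "shuffle_words v = (\<lambda>w. shuffle_words w v)"
    by (rule ext) (rule shuffle_words_commute)
  then show ?thesis
    using multilinear_shuffle_words[of v] by simp
qed

lemma multilinear_shuffle_lift:
  "multilinear (\<bullet>) (\<lambda>v. tensor_lift (\<bullet>) (shuffle_words v) t)"
proof -
  have A: "shuffle_words (u @ (x + y) # v) w =
        shuffle_words (u @ x # v) w + shuffle_words (u @ y # v) w"
    and B: "shuffle_words (u @ (of_const c * x) # v) w = c \<bullet> shuffle_words (u @ x # v) w"
    for u v w c and x y :: 'a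
    using multilinear_shuffle_words[of w] by (auto simp: multilinear_def)
  show ?thesis
    unfolding multilinear_def tensor_lift_def linear_extension_def A B
    by (simp add: tensors.scale_right_distrib sum.distrib tensors.scale_sum_right mult.commute)
qed

lemma module_hom_shuffle_left: "module_hom (\<bullet>) (\<bullet>) (\<lambda>s. s \<squnion>\<squnion> t)"
  unfolding shuffle_def
  by (rule module_hom_tensor_lift[OF tensors.module_axioms multilinear_shuffle_lift])

lemma shuffle_tensor: "tensor v \<squnion>\<squnion> tensor w = shuffle_words v w"
  unfolding shuffle_def tensor_lift_tensor[OF tensors.module_axioms multilinear_shuffle_lift]
  by (rule tensor_lift_tensor[OF tensors.module_axioms multilinear_shuffle_words_right])

lemma module_hom_shuffle_right: "module_hom (\<bullet>) (\<bullet>) (\<lambda>t. s \<squnion>\<squnion> t)"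
proof -
  interpret R: module_hom scale_tensors scale_tensors "tensor_lift (\<bullet>) (shuffle_words v)"
    for v :: "'a list"
    by (rule module_hom_tensor_lift[OF tensors.module_axioms multilinear_shuffle_words_right])
  show ?thesis
    unfolding shuffle_def tensor_lift_def[of _ _ s] linear_extension_def
    by unfold_locales
      (simp_all add: R.add R.scale tensors.scale_right_distrib sum.distrib
        tensors.scale_sum_right mult.commute)
qed

lemma shuffle_empty_left: "(c \<bullet> \<epsilon>) \<squnion>\<squnion> t = c \<bullet> t"
proof -
  interpret L: module_hom scale_tensors scale_tensors "\<lambda>s. s \<squnion>\<squnion> t"
    by (rule module_hom_shuffle_left)
  have "\<epsilon> \<squnion>\<squnion> t = t"
    using tensors_hom_eqI[OF module_hom_shuffle_right tensors.module_hom_id, of \<epsilon>, THEN fun_cong, of t]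
    by (simp add: shuffle_tensor)
  then show ?thesis by (simp add: L.scale)
qed

lemma shuffle_empty_right: "t \<squnion>\<squnion> (c \<bullet> \<epsilon>) = c \<bullet> t"
proof -
  interpret R: module_hom scale_tensors scale_tensors "\<lambda>s. t \<squnion>\<squnion> s"
    by (rule module_hom_shuffle_right)
  have "t \<squnion>\<squnion> \<epsilon> = t"
    using tensors_hom_eqI[OF module_hom_shuffle_left tensors.module_hom_id, of \<epsilon>, THEN fun_cong, of t]
    by (simp add: shuffle_tensor)
  then show ?thesis by (simp add: R.scale)
qed


section \<open>Pure tensors and their segments\<close>

text \<open>
  \<open>segment a i j\<close> is the tensor of \<open>a i, \<dots>, a j\<close> in this order, and \<open>\<epsilon>\<close> if \<open>i = j + 1\<close>.
  The factors of a pure tensor are numbered from 1.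
\<close>

definition segment ::
    "(nat \<Rightarrow> 'a::comm_integro_differential_ring) \<Rightarrow> nat \<Rightarrow> nat \<Rightarrow> 'a tensors"
  where "segment a i j = tensor (map a [i..<j + 1])"

lemma segment_empty: "segment a (j + 1) j = \<epsilon>"
  by (simp add: segment_def)

text \<open>
  \<open>f\<close> is a pure tensor of length \<open>n\<close> with factors \<open>a 1, \<dots>, a n\<close>. The factors are not determined
  by \<open>f\<close>. In length zero there are no factors but an arbitrary constant multiple of \<open>\<epsilon>\<close> is allowed.
\<close>

definition is_pure_tensor ::
    "'a::comm_integro_differential_ring tensors \<Rightarrow> nat \<Rightarrow> (nat \<Rightarrow> 'a) \<Rightarrow> bool"
  where "is_pure_tensor f n a \<longleftrightarrow>
    (if n = 0 then \<exists>c. f = c \<bullet> \<epsilon> else f = segment a 1 n)"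

definition product_constant ::
    "'a::comm_integro_differential_ring tensors \<Rightarrow> 'a tensors \<Rightarrow> 'a" ("\<e>")
  where "\<e> s t = \<E> (\<phi> s * \<phi> t)"

end

theory Submission
  imports Defs
begin

text \<open>
  By definition of the evaluation, a product of two nonempty nested integrals is the integral of
  its derivative plus its evaluation. The derivative, computed with the Leibniz rule, consists of
  two products in which one of the words has lost its first letter. Applying the formula to these
  and integrating prepends that letter again: this is the recursion of the shuffle product, and
  the constants pass through the integral. The evaluation of the product itself is the summand
  \<open>i = j = 0\<close>.
\<close>

lemma integral_0: "\<integral> 0 = (0::'a::comm_integro_differential_ring)"
  using integral_add[of "0::'a" 0] by simp

lemma integral_sum:
  "\<integral> (\<Sum>i\<in>A. h i) = (\<Sum>i\<in>A. \<integral> (h i) :: 'a::comm_integro_differential_ring)"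
  by (induct A rule: infinite_finite_induct) (simp_all add: integral_0 integral_add)

lemma derivation_diff:
  "\<partial> (f - g) = \<partial> f - (\<partial> g :: 'a::comm_integro_differential_ring)"
  using derivation_add[of f "- g"] by (simp add: derivation_minus)

lemma derivation_evaluation: "\<partial> (\<E> f) = (0::'a::comm_integro_differential_ring)"
  by (simp add: evaluation_def derivation_diff derivation_integral)

lemma phi_add: "\<phi> (s + t) = \<phi> s + \<phi> t"
  by (rule module_hom.add[OF module_hom_phi])

lemma phi_scale: "\<phi> (c \<bullet> t) = of_const c * \<phi> t"
  by (simp add: module_hom.scale[OF module_hom_phi] ring_scale_def)

text \<open>Both sides are linear over the constants in \<open>t\<close>, the right one because
  constants pass through the integral. So it suffices to compare them on words, where this is the
  recursion of \<open>nested_integral\<close>.\<close>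

lemma phi_cons_tensor: "\<phi> (cons_tensor x t) = \<integral> (x * \<phi> t)"
proof -
  interpret C: module_hom scale_tensors scale_tensors "cons_tensor x"
    by (rule module_hom_cons_tensor)
  interpret R: module "ring_scale :: 'a const \<Rightarrow> 'a \<Rightarrow> 'a"
    by (rule module_ring_scale)
  have "module_hom scale_tensors ring_scale (\<lambda>t. \<phi> (cons_tensor x t))"
    by unfold_locales (simp_all add: C.add C.scale phi_add phi_scale ring_scale_def)
  moreover have "module_hom scale_tensors ring_scale (\<lambda>t. \<integral> (x * \<phi> t))"
    by unfold_locales
      (simp_all add: phi_add phi_scale ring_scale_def distrib_left integral_add
        mult.left_commute[of x] integral_const_mult[OF derivation_of_const])
  ultimately have "(\<lambda>t. \<phi> (cons_tensor x t)) = (\<lambda>t. \<integral> (x * \<phi> t))"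
    by (rule tensors_hom_eqI) (simp add: cons_tensor_tensor phi_tensor)
  then show ?thesis
    by (rule fun_cong)
qed

text \<open>Prepending a letter shifts one index of the double sum. \<open>A\<close> fills the cells
  with positive row index and \<open>B\<close> those with positive column index: an interior cell
  gets both, a border cell only one, and the corner \<open>G 0 0\<close> neither.\<close>

lemma sum_grid_split:
  fixes A B G :: "nat \<Rightarrow> nat \<Rightarrow> 'a::comm_monoid_add"
  assumes "\<And>i. G (Suc i) 0 = A i 0"
    and "\<And>j. G 0 (Suc j) = B 0 j"
    and "\<And>i j. G (Suc i) (Suc j) = A i (Suc j) + B (Suc i) j"
  shows "(\<Sum>i<Suc m. \<Sum>j<Suc n. G i j) =
    G 0 0 + (\<Sum>i<m. \<Sum>j<Suc n. A i j) + (\<Sum>i<Suc m. \<Sum>j<n. B i j)"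
  by (simp only: sum.lessThan_Suc_shift assms sum.distrib ac_simps)

text \<open>On words the induction can follow the recursion of \<open>shuffle_words\<close>. With
  letters numbered from 1, \<open>take i v\<close> ends at letter \<open>i\<close> and
  \<open>drop i v\<close> begins at letter \<open>i + 1\<close>.\<close>

lemma nested_integral_mult:
  "nested_integral v * nested_integral w = \<phi> (shuffle_words v w) +
    (\<Sum>i<length v. \<Sum>j<length w. \<E> (nested_integral (drop i v) * nested_integral (drop j w)) *
      \<phi> (shuffle_words (take i v) (take j w)))"
proof (induct v w rule: shuffle_words.induct)
  case (1 w)
  then show ?case by (simp add: phi_tensor)
next
  case (2 x v)
  then show ?case by (simp add: phi_tensor)
next
  case (3 x v y w)
  let ?N = nested_integral
  let ?P = "?N (x # v) * ?N (y # w)"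
  \<comment> \<open>\<open>G\<close> is the summand of the claim; \<open>A\<close> and
    \<open>B\<close> are the summands of the two induction hypotheses after multiplication by the
    lost letter and integration. Thus \<open>A i j\<close> belongs to \<open>G (Suc i) j\<close> and
    \<open>B i j\<close> to \<open>G i (Suc j)\<close>.\<close>
  define G where "G i j = \<E> (?N (drop i (x # v)) * ?N (drop j (y # w))) *
    \<phi> (shuffle_words (take i (x # v)) (take j (y # w)))" for i j
  define A where "A i j = \<E> (?N (drop i v) * ?N (drop j (y # w))) *
    \<phi> (cons_tensor x (shuffle_words (take i v) (take j (y # w))))" for i j
  define B where "B i j = \<E> (?N (drop i (x # v)) * ?N (drop j w)) *
    \<phi> (cons_tensor y (shuffle_words (take i (x # v)) (take j w)))" for i j
  have pull: "\<integral> (z * (\<E> p * q)) = \<E> p * \<integral> (z * q)" for z p q :: 'a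
    by (simp add: mult.left_commute[of z] integral_const_mult[OF derivation_evaluation])
  have int_A: "\<integral> (x * (?N v * ?N (y # w))) = \<phi> (cons_tensor x (shuffle_words v (y # w)))
      + (\<Sum>i<length v. \<Sum>j<Suc (length w). A i j)"
    unfolding 3(1) A_def phi_cons_tensor
    by (simp only: distrib_left integral_add sum_distrib_left integral_sum pull length_Cons)
  have int_B: "\<integral> (y * (?N (x # v) * ?N w)) = \<phi> (cons_tensor y (shuffle_words (x # v) w))
      + (\<Sum>i<Suc (length v). \<Sum>j<length w. B i j)"
    unfolding 3(2) B_def phi_cons_tensor
    by (simp only: distrib_left integral_add sum_distrib_left integral_sum pull length_Cons)
  \<comment> \<open>If exactly one prefix is empty, only \<open>A\<close> or only \<open>B\<close>
    contributes; if both are nonempty, the recursion of \<open>shuffle_words\<close> gives one term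
    of each.\<close>
  have split: "(\<Sum>i<Suc (length v). \<Sum>j<Suc (length w). G i j) = G 0 0
      + (\<Sum>i<length v. \<Sum>j<Suc (length w). A i j) + (\<Sum>i<Suc (length v). \<Sum>j<length w. B i j)"
    by (rule sum_grid_split)
      (simp_all add: G_def A_def B_def cons_tensor_tensor phi_add distrib_left
        del: nested_integral.simps)
  have "?P = \<integral> (\<partial> ?P) + \<E> ?P"
    by (simp add: evaluation_def)
  also have "\<partial> ?P = x * (?N v * ?N (y # w)) + y * (?N (x # v) * ?N w)"
    by (simp add: derivation_mult derivation_integral algebra_simps)
  \<comment> \<open>Both prefixes are empty at the corner, and \<phi> maps \<epsilon> to 1.\<close>
  also have "\<E> ?P = G 0 0"
    by (simp add: G_def phi_tensor)
  finally have "?P = \<phi> (shuffle_words (x # v) (y # w))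
      + (\<Sum>i<Suc (length v). \<Sum>j<Suc (length w). G i j)"
    unfolding integral_add int_A int_B split shuffle_words.simps phi_add
    by (simp only: ac_simps)
  then show ?case
    by (simp only: G_def length_Cons)
qed

theorem theorem3p3:
  fixes f g :: "'a::comm_integro_differential_ring tensors"
    and a b :: "nat \<Rightarrow> 'a" and m n :: nat
  assumes "is_pure_tensor f m a" and "is_pure_tensor g n b"
  shows "\<phi> f * \<phi> g = \<phi> (f \<squnion>\<squnion> g) +
      (\<Sum>i<m. \<Sum>j<n. \<e> (segment a (i + 1) m) (segment b (j + 1) n) *
        \<phi> (segment a 1 i \<squnion>\<squnion> segment b 1 j))
    \<and> (\<forall>i<m. \<forall>j<n. \<e> (segment a (i + 1) m) (segment b (j + 1) n) \<in> constants)"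
proof
  show "\<forall>i<m. \<forall>j<n. \<e> (segment a (i + 1) m) (segment b (j + 1) n) \<in> constants"
    by (simp add: product_constant_def constants_def derivation_evaluation)
  \<comment> \<open>A pure tensor of length zero may carry any constant factor \<open>c\<close>, so
    it need not be a segment. Shuffling with it is scaling by \<open>c\<close>, and the double sum
    is empty.\<close>
  consider c where "m = 0" "f = c \<bullet> \<epsilon>" | c where "n = 0" "g = c \<bullet> \<epsilon>"
    | "f = segment a 1 m" "g = segment b 1 n"
    using assms by (auto simp: is_pure_tensor_def split: if_splits)
  then show "\<phi> f * \<phi> g = \<phi> (f \<squnion>\<squnion> g) +
      (\<Sum>i<m. \<Sum>j<n. \<e> (segment a (i + 1) m) (segment b (j + 1) n) *
        \<phi> (segment a 1 i \<squnion>\<squnion> segment b 1 j))"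
  proof cases
    case 1
    then show ?thesis by (simp add: shuffle_empty_left phi_scale phi_tensor)
  next
    case 2
    then show ?thesis by (simp add: shuffle_empty_right phi_scale phi_tensor mult.commute)
  next
    case 3
    let ?v = "map a [1..<m + 1]" and ?w = "map b [1..<n + 1]"
    have segments: "segment h (i + 1) k = tensor (drop i (map h [1..<k + 1]))"
      "segment h 1 i = tensor (take i (map h [1..<k + 1]))"
      if "i < k" for h :: "nat \<Rightarrow> 'a" and i k
      using that by (simp_all add: segment_def drop_map take_map take_upt del: upt_Suc)
    have "\<phi> f * \<phi> g = nested_integral ?v * nested_integral ?w"
      by (simp only: 3 segment_def phi_tensor)
    also have "\<dots> = \<phi> (f \<squnion>\<squnion> g) + (\<Sum>i<m. \<Sum>j<n.
        \<E> (nested_integral (drop i ?v) * nested_integral (drop j ?w)) *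
        \<phi> (shuffle_words (take i ?v) (take j ?w)))"
      using nested_integral_mult[of ?v ?w]
      by (simp add: 3 segment_def shuffle_tensor del: upt_Suc)
    also have "(\<Sum>i<m. \<Sum>j<n.
        \<E> (nested_integral (drop i ?v) * nested_integral (drop j ?w)) *
        \<phi> (shuffle_words (take i ?v) (take j ?w))) =
      (\<Sum>i<m. \<Sum>j<n. \<e> (segment a (i + 1) m) (segment b (j + 1) n) *
        \<phi> (segment a 1 i \<squnion>\<squnion> segment b 1 j))"
      by (intro sum.cong refl)
        (simp only: lessThan_iff segments(1) segments(2)[of _ m a] segments(2)[of _ n b]
          product_constant_def phi_tensor shuffle_tensor)
    finally show ?thesis .
  qed
qed

end
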